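(* The sequence $(K_3,K_3,K_3,K_3)$ is nice. In particular, $r^*(K_3,K_3,K_3,K_3)=R(3,3,3)-1=16$.
   Context: $R(3,3,3)$ is the three-colour Ramsey number of the triangle. A colouring $\xi:\binom{[r]}{\le 2}\to[4]$ (on subsets of $[r]$ of size at most 2) is feasible with respect to $(K_3,K_3,K_3,K_3)$ if (P1) there is no triangle in $[r]$ all of whose pairs receive the same colour, and (P2) $\xi(\{x,y\})\ne\xi(\{x\})$ for all distinct $x,y\in[r]$. $r^*(K_3,K_3,K_3,K_3)$ is the largest $r$ admitting a feasible colouring, and the sequence is nice if every feasible colouring of $\binom{[r^*]}{\le 2}$ assigns the same colour to all singletons. *)

theory Defs
  imports Complex_Main "HOL-Library.Ramsey"
begin

text \<open>
  A list \<^term>\<open>ks :: nat list\<close> stands for the sequence of complete graphs on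
  \<^term>\<open>ks ! 0\<close>, \<^term>\<open>ks ! 1\<close>, and so on vertices, and \<^term>\<open>length ks\<close> is the number of colours.
  As in \<^theory>\<open>HOL-Library.Ramsey\<close>, vertices and colours are counted from 0:
  the vertex set is \<^term>\<open>{..<r :: nat}\<close> and the colour set is \<^term>\<open>{..<length ks}\<close>.
\<close>

definition sets_upto2 :: "nat \<Rightarrow> nat set set" where
  "sets_upto2 r = {S. S \<subseteq> {..<r} \<and> card S \<le> 2}"

text \<open>
  The second conjunct is (P1): \<^term>\<open>monochromatic {..<r} (ks ! c) 2 \<xi> c\<close> says that some
  \<^term>\<open>ks ! c\<close> vertices have all their pairs coloured \<^term>\<open>c\<close>. When all entries of
  \<^term>\<open>ks\<close> are 3, this forbids every monochromatic triangle.
  The third conjunct is (P2).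
\<close>

definition feasible :: "nat list \<Rightarrow> nat \<Rightarrow> (nat set \<Rightarrow> nat) \<Rightarrow> bool" where
  "feasible ks r \<xi> \<longleftrightarrow>
     \<xi> \<in> sets_upto2 r \<rightarrow> {..<length ks} \<and>
     (\<forall>c < length ks. \<not> monochromatic {..<r} (ks ! c) 2 \<xi> c) \<and>
     (\<forall>x < r. \<forall>y < r. x \<noteq> y \<longrightarrow> \<xi> {x, y} \<noteq> \<xi> {x})"

text \<open>
  If there is no largest \<^term>\<open>r\<close>, respectively no \<^term>\<open>n\<close> with the partition property,
  then the following two values are unspecified.
\<close>

definition rstar :: "nat list \<Rightarrow> nat" where
  "rstar ks = (GREATEST r. \<exists>\<xi>. feasible ks r \<xi>)"

definition ramsey_number :: "nat list \<Rightarrow> nat" where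
  "ramsey_number ks = (LEAST n. partn_lst {..<n} ks 2)"

definition nice :: "nat list \<Rightarrow> bool" where
  "nice ks \<longleftrightarrow>
     (\<forall>\<xi>. feasible ks (rstar ks) \<xi> \<longrightarrow> (\<exists>c. \<forall>x < rstar ks. \<xi> {x} = c))"

end

theory Submission
  imports Defs
begin

text \<open>
  Fix a feasible colouring and a vertex \<open>x\<close>. The neighbours of \<open>x\<close> along a colour \<open>j\<close> are not
  themselves coloured \<open>j\<close>, nor are the edges between them. If they all have the same colour, then
  only two colours remain for these edges, so there are at most \<open>R(3,3) - 1 = 5\<close> of them;
  if they have at least two colours, then the edges are so restricted that there are at most 4.
  Hence \<open>r - 1 \<le> 3 \<cdot> 5\<close>. When \<open>r = 16\<close>, every neighbourhood has exactly 5 elements and lies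
  in one colour class, so \<open>5\<close> divides \<open>card (V - {x})\<close> for every class \<open>V\<close> and every vertex \<open>x\<close>.
  Taking \<open>x\<close> inside and outside of \<open>V\<close> shows that there is only one class.
\<close>

section \<open>Monochromatic triangles and the multicolour bound for avoiding them\<close>

lemma monochromatic_3_2_iff:
  "monochromatic S 3 2 \<xi> c \<longleftrightarrow>
    (\<exists>x\<in>S. \<exists>y\<in>S. \<exists>z\<in>S. x \<noteq> y \<and> x \<noteq> z \<and> y \<noteq> z \<and> \<xi> {x, y} = c \<and> \<xi> {x, z} = c \<and> \<xi> {y, z} = c)"
    (is "?L \<longleftrightarrow> ?R")
proof
  assume ?L
  then obtain H where H: "H \<subseteq> S" "card H = 3" "\<xi> ` nsets H 2 \<subseteq> {c}"
    by (auto simp: monochromatic_def nsets_def)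
  then obtain x y z where xyz: "H = {x, y, z}" "x \<noteq> y" "x \<noteq> z" "y \<noteq> z"
    by (auto simp: card_3_iff)
  then have "{x, y} \<in> nsets H 2" "{x, z} \<in> nsets H 2" "{y, z} \<in> nsets H 2"
    by (auto simp: nsets_def)
  then have "\<xi> {x, y} = c" "\<xi> {x, z} = c" "\<xi> {y, z} = c"
    using H(3) by blast+
  then show ?R
    using H(1) xyz by auto
next
  assume ?R
  then obtain x y z where *: "x \<in> S" "y \<in> S" "z \<in> S" "x \<noteq> y" "x \<noteq> z" "y \<noteq> z"
    "\<xi> {x, y} = c" "\<xi> {x, z} = c" "\<xi> {y, z} = c"
    by auto
  have "\<xi> e = c" if e: "e \<in> nsets {x, y, z} 2" for e
  proof -
    from e obtain u v where "e = {u, v}" "u \<noteq> v" "u \<in> {x, y, z}" "v \<in> {x, y, z}"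
      by (auto simp: nsets_def card_2_iff)
    with * show ?thesis by (auto simp: insert_commute)
  qed
  moreover have "{x, y, z} \<in> nsets S 3"
    using * by (auto simp: nsets_def)
  ultimately show ?L
    unfolding monochromatic_def by blast
qed

lemma third_edge_not_monochromatic:
  assumes "\<not> monochromatic S 3 2 \<xi> c" "x \<in> S" "y \<in> S" "z \<in> S" "x \<noteq> y" "x \<noteq> z" "y \<noteq> z"
    and "\<xi> {x, y} = c" "\<xi> {x, z} = c"
  shows "\<xi> {y, z} \<noteq> c"
  using assms(1)[unfolded monochromatic_3_2_iff] assms(2-) by metis

lemma monochromatic_mono:
  "monochromatic S m k \<xi> c \<Longrightarrow> S \<subseteq> T \<Longrightarrow> monochromatic T m k \<xi> c"
  by (auto simp: monochromatic_def nsets_def)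

text \<open>One vertex plus \<open>Suc n\<close> neighbourhoods, each with one colour fewer, gives
  the recursion. For \<open>n \<ge> 1\<close> the value is the integer part of e * n!; for one, two
  and three colours it is R(3)-1, R(3,3)-1 and R(3,3,3)-1.\<close>

fun triangle_bound :: "nat \<Rightarrow> nat" where
  "triangle_bound 0 = 1"
| "triangle_bound (Suc n) = Suc (Suc n * triangle_bound n)"

lemma triangle_bound_values:
  "triangle_bound 1 = 2" "triangle_bound 2 = 5" "triangle_bound 3 = 16"
  by (simp_all add: numeral_eq_Suc)

text \<open>Induction on the number of colours: the neighbours of a vertex \<open>x\<close> along
  \<open>c\<close> span no edge of colour \<open>c\<close>, so \<open>C - {c}\<close> suffices for
  them, and \<open>S\<close> consists of \<open>x\<close> and these neighbourhoods.\<close>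

lemma card_le_triangle_bound:
  assumes "finite C" "finite S"
    and "\<And>x y. x \<in> S \<Longrightarrow> y \<in> S \<Longrightarrow> x \<noteq> y \<Longrightarrow> \<xi> {x, y} \<in> C"
    and "\<And>c. c \<in> C \<Longrightarrow> \<not> monochromatic S 3 2 \<xi> c"
  shows "card S \<le> triangle_bound (card C)"
  using assms
proof (induction "card C" arbitrary: C S)
  case 0
  then have "\<forall>x\<in>S. \<forall>y\<in>S. x = y" by auto
  then have "card S \<le> Suc 0"
    by (simp add: card_le_Suc0_iff_eq \<open>finite S\<close>)
  then show ?case using 0 by simp
next
  case (Suc n)
  show ?case
  proof (cases "S = {}")
    case False
    then obtain x where x: "x \<in> S" by auto
    define N where "N c = {y \<in> S - {x}. \<xi> {x, y} = c}" for c
    have fin: "finite (N c)" for c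
      using \<open>finite S\<close> by (simp add: N_def)
    have bound: "card (N c) \<le> triangle_bound n" if c: "c \<in> C" for c
    proof -
      have n: "n = card (C - {c})"
        using Suc.hyps(2) c \<open>finite C\<close> by simp
      have ne: "\<xi> {y, z} \<noteq> c" if "y \<in> N c" "z \<in> N c" "y \<noteq> z" for y z
        using that x by (intro third_edge_not_monochromatic[OF Suc.prems(4)[OF c], of x])
            (auto simp: N_def)
      have "N c \<subseteq> S" by (auto simp: N_def)
      have "card (N c) \<le> triangle_bound (card (C - {c}))"
      proof (intro Suc.hyps(1)[OF n])
        show "\<not> monochromatic (N c) 3 2 \<xi> c'" if "c' \<in> C - {c}" for c'
          using Suc.prems(4)[of c'] monochromatic_mono[OF _ \<open>N c \<subseteq> S\<close>, of 3 2 \<xi> c'] that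
          by auto
        show "\<xi> {y, z} \<in> C - {c}" if "y \<in> N c" "z \<in> N c" "y \<noteq> z" for y z
          using ne[OF that] Suc.prems(3) \<open>N c \<subseteq> S\<close> that by auto
      qed (use Suc.prems(1) fin in auto)
      then show ?thesis using n by simp
    qed
    have S: "S = insert x (\<Union>c\<in>C. N c)"
      using x Suc.prems(3)[OF x] by (auto simp: N_def)
    have "card S \<le> Suc (card (\<Union>c\<in>C. N c))"
      by (subst S) (simp add: card_insert_le_m1 card_insert_if \<open>finite C\<close> fin)
    also have "card (\<Union>c\<in>C. N c) \<le> (\<Sum>c\<in>C. card (N c))"
      by (rule card_UN_le[OF \<open>finite C\<close>])
    also have "\<dots> \<le> card C * triangle_bound n"
      using sum_bounded_above[of C "\<lambda>c. card (N c)"] bound by simp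
    finally show ?thesis
      using Suc.hyps(2) by (metis Suc_le_mono triangle_bound.simps(2))
  qed simp
qed

section \<open>Feasible colourings in four colours\<close>

lemma feasible_3333_iff:
  "feasible [3,3,3,3] r \<xi> \<longleftrightarrow>
     \<xi> \<in> sets_upto2 r \<rightarrow> {..<4} \<and>
     (\<forall>c < 4. \<not> monochromatic {..<r} 3 2 \<xi> c) \<and>
     (\<forall>x < r. \<forall>y < r. x \<noteq> y \<longrightarrow> \<xi> {x, y} \<noteq> \<xi> {x})"
proof -
  \<comment> \<open>As a \<open>replicate\<close>, the list yields 3 at every valid index without a
    case split on the colour.\<close>
  have "[3,3,3,3] = replicate 4 (3::nat)" by (simp add: numeral_eq_Suc)
  then show ?thesis by (simp add: feasible_def)
qed

lemma feasibleD:
  assumes "feasible [3,3,3,3] r \<xi>"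
  shows "x < r \<Longrightarrow> \<xi> {x} < 4"
    and "x < r \<Longrightarrow> y < r \<Longrightarrow> \<xi> {x, y} < 4"
    and "x < r \<Longrightarrow> y < r \<Longrightarrow> x \<noteq> y \<Longrightarrow> \<xi> {x, y} \<noteq> \<xi> {x}"
    and "x < r \<Longrightarrow> y < r \<Longrightarrow> x \<noteq> y \<Longrightarrow> \<xi> {x, y} \<noteq> \<xi> {y}"
    and "c < 4 \<Longrightarrow> \<not> monochromatic {..<r} 3 2 \<xi> c"
proof -
  note * = assms[unfolded feasible_3333_iff]
  have "{x, y} \<in> sets_upto2 r" if "x < r" "y < r" for x y
    using that by (auto simp: sets_upto2_def card_insert_if)
  with * show **: "x < r \<Longrightarrow> y < r \<Longrightarrow> \<xi> {x, y} < 4" for x y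
    by auto
  show "x < r \<Longrightarrow> \<xi> {x} < 4"
    using **[of x x] by simp
  show "x < r \<Longrightarrow> y < r \<Longrightarrow> x \<noteq> y \<Longrightarrow> \<xi> {x, y} \<noteq> \<xi> {x}"
    using * by auto
  show "x < r \<Longrightarrow> y < r \<Longrightarrow> x \<noteq> y \<Longrightarrow> \<xi> {x, y} \<noteq> \<xi> {y}"
    using * by (metis insert_commute)
  show "c < 4 \<Longrightarrow> \<not> monochromatic {..<r} 3 2 \<xi> c"
    using * by simp
qed

section \<open>Neighbourhoods along a colour\<close>

definition neighbours :: "nat \<Rightarrow> (nat set \<Rightarrow> nat) \<Rightarrow> nat \<Rightarrow> nat \<Rightarrow> nat set" where
  "neighbours r \<xi> x j = {y. y < r \<and> y \<noteq> x \<and> \<xi> {x, y} = j}"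

lemma finite_neighbours [simp]: "finite (neighbours r \<xi> x j)"
  by (simp add: neighbours_def)

lemma card_neighbours:
  assumes feas: "feasible [3,3,3,3] r \<xi>" and x: "x < r" and j: "j < 4"
  shows "card (neighbours r \<xi> x j) \<le> 5"
    and "card (neighbours r \<xi> x j) = 5 \<Longrightarrow>
      \<exists>a. \<forall>y\<in>neighbours r \<xi> x j. \<xi> {y} = a"
proof -
  note f = feasibleD[OF feas]
  let ?N = "neighbours r \<xi> x j"
  define T where "T a = {y \<in> ?N. \<xi> {y} = a}" for a
  have N: "y < r" "y \<noteq> x" "\<xi> {x, y} = j" "\<xi> {y} \<noteq> j" if "y \<in> ?N" for y
    using that f(4)[OF x, of y] by (auto simp: neighbours_def)
  have edge_ne: "\<xi> {y, z} \<noteq> j" if "y \<in> ?N" "z \<in> ?N" "y \<noteq> z" for y z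
    using N[OF that(1)] N[OF that(2)] that(3) x
    by (intro third_edge_not_monochromatic[OF f(5)[OF j], of x]) auto
  have mono: "\<not> monochromatic S 3 2 \<xi> c" if "S \<subseteq> ?N" "c < 4" for S c
    using f(5)[OF that(2)] that(1) N(1) monochromatic_mono[of S 3 2 \<xi> c "{..<r}"] by blast
  have bound: "card S \<le> triangle_bound (card C)"
    if "S \<subseteq> ?N" "C \<subseteq> {..<4}" "\<And>y z. y \<in> S \<Longrightarrow> z \<in> S \<Longrightarrow> y \<noteq> z \<Longrightarrow> \<xi> {y, z} \<in> C" for S C
  proof (rule card_le_triangle_bound)
    show "finite C" using finite_subset[OF that(2)] by simp
    show "finite S" using finite_subset[OF that(1)] by simp
    show "\<not> monochromatic S 3 2 \<xi> c" if "c \<in> C" for c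
      using mono \<open>S \<subseteq> ?N\<close> \<open>C \<subseteq> {..<4}\<close> that by blast
  qed (use that in auto)
  have "card ?N \<le> 5" if "\<forall>y\<in>?N. \<xi> {y} = a" for a
  proof (cases "?N = {}")
    case False
    then obtain y0 where y0: "y0 \<in> ?N" by auto
    then have a: "a \<noteq> j" "a < 4" using that N[of y0] f(1)[of y0] by auto
    \<comment> \<open>Edges inside \<open>?N\<close> avoid \<open>j\<close> and, by (P2), also
      \<open>a\<close>; two colours remain, and \<open>triangle_bound 2\<close> is 5.\<close>
    have "card ?N \<le> triangle_bound (card ({..<4} - {j, a}))"
    proof (rule bound)
      show "\<xi> {y, z} \<in> {..<4} - {j, a}" if yz: "y \<in> ?N" "z \<in> ?N" "y \<noteq> z" for y z
        using edge_ne[OF yz] f(2,3)[OF N(1)[OF yz(1)] N(1)[OF yz(2)]] yz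
          \<open>\<forall>y\<in>?N. \<xi> {y} = a\<close> by simp
    qed auto
    moreover have "card ({..<4} - {j, a}) = 2"
      using a j by (subst card_Diff_subset) auto
    ultimately show ?thesis by (simp add: triangle_bound_values)
  qed simp
  \<comment> \<open>The strict bound 4 in this case is what forces a neighbourhood of size 5 into a
    single class.\<close>
  moreover have "card ?N \<le> 4" if several: "\<nexists>a. \<forall>y\<in>?N. \<xi> {y} = a"
  proof -
    obtain y0 y1 where y: "y0 \<in> ?N" "y1 \<in> ?N" "\<xi> {y0} \<noteq> \<xi> {y1}"
      using several by metis
    define a b where "a = \<xi> {y0}" and "b = \<xi> {y1}"
    have ab: "a < 4" "b < 4" "a \<noteq> j" "b \<noteq> j" "a \<noteq> b"
      using y N f(1) by (auto simp: a_def b_def)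
    have "card ({..<4} - {j, a, b}) = 1"
      using ab j by (subst card_Diff_subset) auto
    then obtain c where c: "{..<4} - {j, a, b} = {c}"
      by (auto simp: card_1_singleton_iff)
    then have c': "c < 4" "c \<noteq> j" "c \<noteq> a" "c \<noteq> b" by auto
    have all: "u \<in> {j, a, b, c}" if "u < 4" for u
      using c that by auto
    \<comment> \<open>By (P2) no neighbour along \<open>j\<close> is itself coloured
      \<open>j\<close>, so only three classes can occur.\<close>
    have NT: "?N = T a \<union> T b \<union> T c"
      using all f(1) N unfolding T_def by blast
    \<comment> \<open>Edges between \<open>T p\<close> and \<open>T q\<close> avoid
      \<open>j\<close>, \<open>p\<close> and \<open>q\<close>, so all have the one remaining colour
      \<open>s\<close>. The triangle \<open>u\<close>, \<open>v\<close>, \<open>w\<close> then keeps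
      \<open>{u, v}\<close> off \<open>s\<close>; as it also avoids \<open>j\<close> and
      \<open>p\<close>, only \<open>q\<close> is left.\<close>
    have key: "\<xi> {u, v} = q"
      if pq: "p < 4" "q < 4" "p \<noteq> j" "q \<noteq> j" "p \<noteq> q" and w: "w \<in> T q"
        and uv: "u \<in> T p" "v \<in> T p" "u \<noteq> v" for p q u v w
    proof -
      have "card ({..<4} - {j, p, q}) = 1"
        using pq j by (subst card_Diff_subset) auto
      then obtain s where s: "{..<4} - {j, p, q} = {s}"
        by (auto simp: card_1_singleton_iff)
      have uvw: "u \<in> ?N" "v \<in> ?N" "w \<in> ?N" "\<xi> {u} = p" "\<xi> {v} = p" "\<xi> {w} = q"
        using w uv by (auto simp: T_def)
      then have ne: "u \<noteq> w" "v \<noteq> w" using pq by auto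
      note lt = N(1)[OF uvw(1)] N(1)[OF uvw(2)] N(1)[OF uvw(3)]
      have "\<xi> {u, w} \<in> {..<4} - {j, p, q}" "\<xi> {v, w} \<in> {..<4} - {j, p, q}"
        using uvw ne lt f(2,3,4)[of u w] f(2,3,4)[of v w] edge_ne[of u w] edge_ne[of v w] by auto
      then have sw: "\<xi> {u, w} = s" "\<xi> {v, w} = s" unfolding s by auto
      have "s < 4" using s by auto
      have "\<xi> {u, v} \<noteq> s"
        using sw lt ne uv(3)
        by (intro third_edge_not_monochromatic[OF f(5)[OF \<open>s < 4\<close>], of w])
            (auto simp: insert_commute)
      moreover have "\<xi> {u, v} \<in> {..<4}" "\<xi> {u, v} \<noteq> j" "\<xi> {u, v} \<noteq> p"
        using uvw lt uv(3) f(2,3)[of u v] edge_ne[of u v] by auto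
      ultimately show ?thesis using s by blast
    qed
    \<comment> \<open>All edges inside \<open>T p\<close> have the single colour \<open>q\<close>,
      so three vertices would form a monochromatic triangle.\<close>
    have two: "card (T p) \<le> 2"
      if "p < 4" "q < 4" "p \<noteq> j" "q \<noteq> j" "p \<noteq> q" "w \<in> T q" for p q w
      using bound[of "T p" "{q}"] key[OF that] that
      by (simp add: T_def triangle_bound_values[unfolded One_nat_def] del: triangle_bound.simps)
    \<comment> \<open>With two other classes inhabited, an edge inside \<open>T p\<close> would have
      both colours \<open>q\<close> and \<open>s\<close>.\<close>
    have one: "card (T p) \<le> 1"
      if "p < 4" "q < 4" "s < 4" "p \<noteq> j" "q \<noteq> j" "s \<noteq> j" "p \<noteq> q" "p \<noteq> s" "q \<noteq> s"
        "w \<in> T q" "z \<in> T s" for p q s w z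
    proof -
      have "u = v" if "u \<in> T p" "v \<in> T p" for u v
        using key[of p q w u v] key[of p s z u v] that \<open>p < 4\<close> \<open>q < 4\<close> \<open>s < 4\<close>
          \<open>p \<noteq> j\<close> \<open>q \<noteq> j\<close> \<open>s \<noteq> j\<close> \<open>p \<noteq> q\<close> \<open>p \<noteq> s\<close> \<open>q \<noteq> s\<close> \<open>w \<in> T q\<close> \<open>z \<in> T s\<close> by metis
      moreover have "finite (T p)" by (simp add: T_def)
      ultimately show ?thesis by (simp add: card_le_Suc0_iff_eq)
    qed
    have yT: "y0 \<in> T a" "y1 \<in> T b"
      using y by (auto simp: T_def a_def b_def)
    have "card ?N \<le> card (T a) + card (T b) + card (T c)"
      unfolding NT by (meson add_le_mono card_Un_le le_trans order_refl)
    \<comment> \<open>Either two classes of at most 2 elements occur, or three of at most 1.\<close>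
    moreover have "card (T a) + card (T b) + card (T c) \<le> 4"
    proof (cases "T c = {}")
      case True
      then show ?thesis
        using two[of a b y1] two[of b a y0] yT ab by simp
    next
      case False
      then obtain y2 where "y2 \<in> T c" by auto
      then show ?thesis
        using one[of a b c y1 y2] one[of b a c y0 y2] one[of c a b y0 y1] yT ab c' by simp
    qed
    ultimately show ?thesis by linarith
  qed
  ultimately show "card ?N \<le> 5" "card ?N = 5 \<Longrightarrow> \<exists>a. \<forall>y\<in>?N. \<xi> {y} = a"
    by force+
qed

text \<open>By (P2) no edge at \<open>x\<close> has the colour of \<open>x\<close>, so the other
  three colours split \<open>A - {x}\<close>. \<open>A\<close> will be the whole vertex set or one
  colour class.\<close>

lemma card_eq_sum_neighbours:
  assumes feas: "feasible [3,3,3,3] r \<xi>" and x: "x < r" and A: "A \<subseteq> {..<r}"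
  shows "card (A - {x}) = (\<Sum>j\<in>{..<4} - {\<xi> {x}}. card (A \<inter> neighbours r \<xi> x j))"
proof -
  have "A - {x} = (\<Union>j\<in>{..<4} - {\<xi> {x}}. A \<inter> neighbours r \<xi> x j)"
    using A x feasibleD(2,3)[OF feas x] by (auto simp: neighbours_def)
  also have "card \<dots> = (\<Sum>j\<in>{..<4} - {\<xi> {x}}. card (A \<inter> neighbours r \<xi> x j))"
    by (rule card_UN_disjoint) (auto simp: neighbours_def)
  finally show ?thesis .
qed

section \<open>At most 16 vertices, and a single vertex colour at 16\<close>

lemma feasible_le_16:
  assumes feas: "feasible [3,3,3,3] r \<xi>"
  shows "r \<le> 16"
proof (cases "r = 0")
  case False
  then have x: "0 < r" by simp
  have le: "card ({..<r} \<inter> neighbours r \<xi> 0 j) \<le> 5" if "j \<in> {..<4} - {\<xi> {0}}" for j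
    using card_neighbours(1)[OF feas x, of j] that
    by (metis DiffD1 Int_lower2 card_mono finite_neighbours le_trans lessThan_iff)
  have "r - 1 = card ({..<r} - {0})" using x by simp
  also have "\<dots> = (\<Sum>j\<in>{..<4} - {\<xi> {0}}. card ({..<r} \<inter> neighbours r \<xi> 0 j))"
    by (rule card_eq_sum_neighbours[OF feas x order_refl])
  also have "\<dots> \<le> card ({..<4} - {\<xi> {0}}) * 5"
    using sum_bounded_above[of "{..<4} - {\<xi> {0}}" _ 5, OF le] by simp
  also have "card ({..<4} - {\<xi> {0}}) = 3"
    using feasibleD(1)[OF feas x] by simp
  finally show ?thesis by simp
qed simp

lemma five_dvd_card_class:
  assumes feas: "feasible [3,3,3,3] 16 \<xi>" and x: "x < 16"
  shows "5 dvd card ({y. y < 16 \<and> \<xi> {y} = k} - {x})"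
proof -
  let ?J = "{..<4} - {\<xi> {x}}" and ?N = "neighbours 16 \<xi> x"
  have J: "card ?J = 3"
    using feasibleD(1)[OF feas x] by simp
  have le: "card (?N j) \<le> 5" if "j \<in> ?J" for j
    using card_neighbours(1)[OF feas x] that by simp
  have "15 = card ({..<16} - {x})" using x by simp
  also have "\<dots> = (\<Sum>j\<in>?J. card ({..<16} \<inter> ?N j))"
    by (rule card_eq_sum_neighbours[OF feas x order_refl])
  also have "\<dots> = (\<Sum>j\<in>?J. card (?N j))"
    by (intro sum.cong refl arg_cong[of _ _ card]) (auto simp: neighbours_def)
  finally have sum: "(\<Sum>j\<in>?J. card (?N j)) = (\<Sum>j\<in>?J. 5)" using J by simp
  \<comment> \<open>Three summands of at most 5 that add up to 15 are all 5.\<close>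
  have five: "card (?N j) = 5" if "j \<in> ?J" for j
    using sum_mono_inv[OF sum le that] by simp
  have "5 dvd card ({y. y < 16 \<and> \<xi> {y} = k} \<inter> ?N j)" if j: "j \<in> ?J" for j
  proof -
    obtain a where a: "\<forall>y\<in>?N j. \<xi> {y} = a"
      using card_neighbours(2)[OF feas x _ five[OF j]] j by auto
    \<comment> \<open>A neighbourhood lies in one class, so it meets the class of \<open>k\<close>
      in all 5 points or in none.\<close>
    then have "{y. y < 16 \<and> \<xi> {y} = k} \<inter> ?N j = (if a = k then ?N j else {})"
      by (auto simp: neighbours_def)
    then show ?thesis using five[OF j] by simp
  qed
  then show ?thesis
    by (subst card_eq_sum_neighbours[OF feas x]) (auto intro!: dvd_sum)
qed

lemma feasible_16_singletons:
  assumes feas: "feasible [3,3,3,3] 16 \<xi>" and x: "x < 16" and y: "y < 16"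
  shows "\<xi> {x} = \<xi> {y}"
proof (rule ccontr)
  assume ne: "\<xi> {x} \<noteq> \<xi> {y}"
  let ?V = "{z. z < 16 \<and> \<xi> {z} = \<xi> {x}}"
  \<comment> \<open>As \<open>x\<close> lies in \<open>?V\<close> and \<open>y\<close> does not, the
    two cardinalities are consecutive, and 5 cannot divide both.\<close>
  have "?V - {y} = insert x (?V - {x})" using ne x by auto
  then have "card (?V - {y}) = Suc (card (?V - {x}))"
    by (simp del: insert_Diff_single)
  then show False
    using five_dvd_card_class[OF feas x, of "\<xi> {x}"] five_dvd_card_class[OF feas y, of "\<xi> {x}"]
    by presburger
qed

section \<open>A feasible colouring on 16 vertices\<close>

text \<open>
  Identify \<open>{..<16}\<close> with the field of 16 elements, presented as \<open>GF(2)[\<alpha>]\<close> with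
  \<open>\<alpha>^4 = \<alpha> + 1\<close>, by reading binary digits as coefficients; addition is \<open>xor\<close>.
  The colour of an edge is the coset, modulo the subgroup of nonzero cubes
  \<open>{1, 8, 10, 12, 15}\<close>, that contains the difference of its ends. The cosets are sum-free.
\<close>

definition cubic_coset :: "nat \<Rightarrow> nat" where
  "cubic_coset d =
    (if d \<in> {1, 8, 10, 12, 15} then 0 else if d \<in> {2, 3, 7, 11, 13} then 1 else 2)"

definition cubic_colouring :: "nat set \<Rightarrow> nat" where
  "cubic_colouring S = (if card S = 2 then cubic_coset (xor (Min S) (Max S)) else 3)"

lemma cubic_colouring_edge: "x \<noteq> y \<Longrightarrow> cubic_colouring {x, y} = cubic_coset (xor x y)"
  by (simp add: cubic_colouring_def min_def max_def xor.commute)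

text \<open>A finite check, with ranges given as lists for evaluation. \<open>d \<noteq> e\<close>
  excludes the sum 0, which \<open>cubic_coset\<close> sends to 2 by default.\<close>

lemma cubic_coset_sum_free:
  "\<forall>d\<in>set [1..<16]. \<forall>e\<in>set [1..<16]. d \<noteq> e \<longrightarrow> cubic_coset d = cubic_coset e \<longrightarrow>
    cubic_coset (xor d e) \<noteq> cubic_coset d"
  by code_simp

lemma xor_less_2_power: "x < 2 ^ n \<Longrightarrow> y < 2 ^ n \<Longrightarrow> xor x y < (2 ^ n :: nat)"
  by (metis take_bit_nat_eq_self_iff take_bit_xor)

lemma xor_eq_0_iff: "xor x y = 0 \<longleftrightarrow> x = (y :: nat)"
  by (metis xor_self_eq xor.right_neutral xor.assoc)

text \<open>In characteristic 2 the differences along two sides of a triangle add up to the third,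
  so a monochromatic triangle would violate sum-freeness.\<close>

lemma cubic_colouring_not_monochromatic:
  "\<not> monochromatic {..<16} 3 2 cubic_colouring c"
proof
  assume "monochromatic {..<16} 3 2 cubic_colouring c"
  then obtain x y z where xyz: "x < 16" "y < 16" "z < 16" "x \<noteq> y" "x \<noteq> z" "y \<noteq> z"
    and "cubic_colouring {x, y} = c" "cubic_colouring {x, z} = c" "cubic_colouring {y, z} = c"
    unfolding monochromatic_3_2_iff by auto
  then have c: "cubic_coset (xor x y) = c" "cubic_coset (xor x z) = c" "cubic_coset (xor y z) = c"
    by (simp_all add: cubic_colouring_edge)
  have "xor u v \<in> set [1..<16]" if "u < 16" "v < 16" "u \<noteq> v" for u v :: nat
    using xor_less_2_power[of u 4 v] xor_eq_0_iff[of u v] that by (simp add: Suc_le_eq)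
  then have "xor x y \<in> set [1..<16]" "xor x z \<in> set [1..<16]"
    using xyz by blast+
  moreover have yz: "xor (xor x y) (xor x z) = xor y z"
    by (metis xor.assoc xor.commute xor.left_neutral xor_self_eq)
  moreover have "xor x y \<noteq> xor x z"
    using yz xyz(6) xor_eq_0_iff by metis
  ultimately show False
    using cubic_coset_sum_free c by metis
qed

lemma cubic_colouring_less_3: "card S = 2 \<Longrightarrow> cubic_colouring S < 3"
  by (simp add: cubic_colouring_def cubic_coset_def)

text \<open>Pairs use only the colours 0, 1 and 2 while singletons get 3, which secures
  (P2).\<close>

lemma feasible_cubic_colouring: "feasible [3,3,3,3] 16 cubic_colouring"
proof -
  have "cubic_colouring S < 4" for S
    by (simp add: cubic_colouring_def cubic_coset_def)
  moreover have "cubic_colouring {x, y} \<noteq> cubic_colouring {x}" if "x \<noteq> y" for x y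
    using cubic_colouring_less_3[of "{x, y}"] that by (simp add: cubic_colouring_def)
  ultimately show ?thesis
    using cubic_colouring_not_monochromatic by (simp add: feasible_3333_iff)
qed

lemma rstar_3333: "rstar [3,3,3,3] = 16"
  unfolding rstar_def
proof (rule Greatest_equality)
  show "\<exists>\<xi>. feasible [3,3,3,3] 16 \<xi>"
    by (rule exI[of _ cubic_colouring]) (rule feasible_cubic_colouring)
  show "r \<le> 16" if "\<exists>\<xi>. feasible [3,3,3,3] r \<xi>" for r
    using that feasible_le_16 by auto
qed

section \<open>The Ramsey number R(3,3,3)\<close>

lemma partn_lst_333_iff:
  "partn_lst B [3,3,3] 2 \<longleftrightarrow> 
    (\<forall>f \<in> nsets B 2 \<rightarrow> {..<3::nat}. \<exists>c<3. monochromatic B 3 2 f c)"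
proof -
  have "[3,3,3] = replicate 3 (3::nat)" by (simp add: numeral_eq_Suc)
  then show ?thesis by (simp add: partn_lst_def cong: conj_cong)
qed

text \<open>The upper bound is \<open>triangle_bound 3 = 16\<close>; for the lower bound,
  \<open>cubic_colouring\<close> restricted to pairs is a 3-colouring without monochromatic
  triangles.\<close>

lemma ramsey_number_333: "ramsey_number [3,3,3] = 17"
  unfolding ramsey_number_def
proof (rule Least_equality)
  show "partn_lst {..<17::nat} [3,3,3] 2"
    unfolding partn_lst_333_iff
  proof (intro ballI, rule ccontr)
    fix f assume f: "f \<in> nsets {..<17::nat} 2 \<rightarrow> {..<3::nat}"
      "\<not> (\<exists>c<3. monochromatic {..<17} 3 2 f c)"
    have "card {..<17::nat} \<le> triangle_bound (card {..<3::nat})"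
    proof (rule card_le_triangle_bound[where \<xi> = f])
      show "f {x, y} \<in> {..<3}" if "x \<in> {..<17}" "y \<in> {..<17}" "x \<noteq> y" for x y
        using f(1) that by (auto simp: nsets_def Pi_iff)
      show "\<not> monochromatic {..<17} 3 2 f c" if "c \<in> {..<3}" for c
        using f(2) that by simp
    qed auto
    then show False by (simp add: triangle_bound_values)
  qed
  show "17 \<le> n" if n: "partn_lst {..<n} [3,3,3] 2" for n :: nat
  proof (rule ccontr)
    assume "\<not> ?thesis"
    then have le: "{..<n} \<subseteq> {..<16}" by auto
    have "cubic_colouring \<in> nsets {..<n} 2 \<rightarrow> {..<3}"
      using cubic_colouring_less_3 by (auto simp: nsets_def)
    then obtain c where "c < 3" and c: "monochromatic {..<n} 3 2 cubic_colouring c"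
      using n unfolding partn_lst_333_iff by blast
    have "monochromatic {..<16} 3 2 cubic_colouring c"
      by (rule monochromatic_mono[OF c le])
    then show False by (simp add: cubic_colouring_not_monochromatic)
  qed
qed

theorem theorem1p9:
  shows "nice [3, 3, 3, 3] \<and>
    rstar [3, 3, 3, 3] = ramsey_number [3, 3, 3] - 1 \<and>
    ramsey_number [3, 3, 3] - 1 = 16"
proof -
  have "nice [3, 3, 3, 3]"
    unfolding nice_def rstar_3333 using feasible_16_singletons by blast
  then show ?thesis
    by (simp add: rstar_3333 ramsey_number_333)
qed

end
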